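(* Let $X$ be a Banach space with the Daugavet property and let $F\in\mathcal{F}_{2,2}\cup\mathcal{F}_{2,3}$. Let $c_1=(1,\hat{x}_1)$, $c_2=(\hat{x}_2,1)$, where $\hat{x}_1=\max\{y:(1,y)\in S_F^+\}$ and $\hat{x}_2=\max\{x:(x,1)\in S_F^+\}$ (so that $[c_1,c_2]\subset S_F^+$), and let $(f_1,f_2)\in S_{F^*}^+$ be such that the line containing the segment $[c_1,c_2]$ has the equation $f_1a_1+f_2a_2=1$. Then the operator $G:X\oplus_F X\to X$, $G(x_1,x_2)=f_1x_1+f_2x_2$, is a Daugavet center.
   Context: All Banach spaces are real and different from $\{0\}$. A nonzero continuous linear operator $G:X\to Y$ between Banach spaces is a Daugavet center if every (bounded) rank-1 operator $T:X\to Y$ satisfies $\|G+T\|=\|G\|+\|T\|$. $X$ has the Daugavet property if the identity operator $\mathrm{Id}:X\to X$ is a Daugavet center. A two-dimensional lattice is a space $F=(\mathbb{R}^2,\|\cdot\|)$, where the norm satisfies $\|(1,0)\|=\|(0,1)\|=1$ and $\|(a_1,a_2)\|=\|(|a_1|,|a_2|)\|$ for all $(a_1,a_2)$, ordered coordinatewise. Its dual $F^*$ is $\mathbb{R}^2$ with $\|(f_1,f_2)\|_{F^*}=\max_{(a_1,a_2)\in B_F}|f_1a_1+f_2a_2|$, where $B_F$ is the closed unit ball; $F^*$ is again a two-dimensional lattice. $S_F^+=\{a\in F:\|a\|=1,\ a\ge 0\}$, and similarly $S_{F^*}^+$. For Banach spaces $X_1,X_2$, $X_1\oplus_F X_2$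 is the space of pairs $(x_1,x_2)$, $x_i\in X_i$, with norm $\|(x_1,x_2)\|=\|(\|x_1\|,\|x_2\|)\|_F$. We say $S_F^+$ is a polygon with $n$ edges if it is a polygonal arc from $(1,0)$ to $(0,1)$ consisting of exactly $n$ edges (maximal nondegenerate line segments). With $\hat{x}_1,\hat{x}_2$ as in the claim, and $S_F^+$ a polygon with $n$ edges: $F\in\mathcal{F}_{n-1,n}$ if $\hat{x}_1>0$ and $\hat{x}_2>0$; $F\in\mathcal{F}_{n,n}$ if exactly one of $\hat{x}_1,\hat{x}_2$ equals zero. Thus $\mathcal{F}_{2,2}$ consists of those $F$ with two edges and exactly one $\hat{x}_j=0$, and $\mathcal{F}_{2,3}$ of those $F$ with three edges and both $\hat{x}_j>0$. *)

theory Defs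
  imports "HOL-Analysis.Analysis"
begin

text \<open>
  The norm of \<open>X \<oplus>\<^sub>F X\<close> depends on the lattice \<open>F\<close>, which is a term and not a type.
  So the notions about operators take the norms of the domain and of the codomain as
  explicit arguments. For the norm of a type of class \<^class>\<open>banach\<close> they agree with the
  library's notions; see the lemmas below.
\<close>

definition norm_fun :: "('a::real_vector \<Rightarrow> real) \<Rightarrow> bool" where
  "norm_fun p \<longleftrightarrow>
     (\<forall>x. p x = 0 \<longleftrightarrow> x = 0) \<and>
     (\<forall>x y. p (x + y) \<le> p x + p y) \<and>
     (\<forall>c x. p (c *\<^sub>R x) = \<bar>c\<bar> * p x)"

definition banach_norm :: "('a::real_vector \<Rightarrow> real) \<Rightarrow> bool" where
  "banach_norm p \<longleftrightarrow> norm_fun p \<and> Metric_space.mcomplete UNIV (\<lambda>x y. p (x - y))"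

definition bounded_linear_wrt ::
    "('a::real_vector \<Rightarrow> real) \<Rightarrow> ('b::real_vector \<Rightarrow> real) \<Rightarrow> ('a \<Rightarrow> 'b) \<Rightarrow> bool" where
  "bounded_linear_wrt p q T \<longleftrightarrow> linear T \<and> (\<exists>K. \<forall>x. q (T x) \<le> p x * K)"

definition onorm_wrt :: "('a \<Rightarrow> real) \<Rightarrow> ('b \<Rightarrow> real) \<Rightarrow> ('a \<Rightarrow> 'b) \<Rightarrow> real" where
  "onorm_wrt p q T = (SUP x. q (T x) / p x)"

definition rank_one_operator ::
    "('a::real_vector \<Rightarrow> real) \<Rightarrow> ('b::real_vector \<Rightarrow> real) \<Rightarrow> ('a \<Rightarrow> 'b) \<Rightarrow> bool" where
  "rank_one_operator p q T \<longleftrightarrow> bounded_linear_wrt p q T \<and> dim (range T) = 1"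

definition Daugavet_center ::
    "('a::real_vector \<Rightarrow> real) \<Rightarrow> ('b::real_vector \<Rightarrow> real) \<Rightarrow> ('a \<Rightarrow> 'b) \<Rightarrow> bool" where
  "Daugavet_center p q G \<longleftrightarrow>
     banach_norm p \<and> banach_norm q \<and>
     bounded_linear_wrt p q G \<and> (\<exists>x. G x \<noteq> 0) \<and>
     (\<forall>T. rank_one_operator p q T \<longrightarrow>
        onorm_wrt p q (\<lambda>x. G x + T x) = onorm_wrt p q G + onorm_wrt p q T)"

text \<open>
  As \<^const>\<open>Daugavet_center\<close> requires a nonzero operator, the Daugavet property entails
  that the space is different from \<open>{0}\<close>.
\<close>
definition Daugavet_property :: "('a::real_vector \<Rightarrow> real) \<Rightarrow> bool" where
  "Daugavet_property p \<longleftrightarrow> Daugavet_center p p (\<lambda>x. x)"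

lemma banach_norm_norm: "banach_norm (norm :: 'a::banach \<Rightarrow> real)"
proof -
  have "(\<lambda>x y. norm (x - y)) = (dist :: 'a \<Rightarrow> 'a \<Rightarrow> real)"
    by (simp add: dist_norm fun_eq_iff)
  then show ?thesis
    using complete_UNIV[where 'a = 'a] by (simp add: banach_norm_def norm_fun_def norm_triangle_ineq)
qed

lemma bounded_linear_wrt_norm: "bounded_linear_wrt norm norm T \<longleftrightarrow> bounded_linear T"
  by (simp add: bounded_linear_wrt_def bounded_linear_def bounded_linear_axioms_def)

lemma onorm_wrt_norm: "onorm_wrt norm norm T = onorm T"
  by (simp add: onorm_wrt_def onorm_def)

definition two_dim_lattice :: "(real \<times> real \<Rightarrow> real) \<Rightarrow> bool" where
  "two_dim_lattice F \<longleftrightarrow>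
     norm_fun F \<and> F (1, 0) = 1 \<and> F (0, 1) = 1 \<and>
     (\<forall>a\<^sub>1 a\<^sub>2. F (a\<^sub>1, a\<^sub>2) = F (\<bar>a\<^sub>1\<bar>, \<bar>a\<^sub>2\<bar>))"

text \<open>The supremum is a maximum, because the unit ball of \<open>F\<close> is compact.\<close>
definition dual_lattice :: "(real \<times> real \<Rightarrow> real) \<Rightarrow> real \<times> real \<Rightarrow> real" where
  "dual_lattice F = (\<lambda>(f\<^sub>1, f\<^sub>2). Sup {\<bar>f\<^sub>1 * a\<^sub>1 + f\<^sub>2 * a\<^sub>2\<bar> | a\<^sub>1 a\<^sub>2. F (a\<^sub>1, a\<^sub>2) \<le> 1})"

definition pos_sphere :: "(real \<times> real \<Rightarrow> real) \<Rightarrow> (real \<times> real) set" where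
  "pos_sphere F = {(a\<^sub>1, a\<^sub>2). F (a\<^sub>1, a\<^sub>2) = 1 \<and> 0 \<le> a\<^sub>1 \<and> 0 \<le> a\<^sub>2}"

definition sum_norm ::
    "(real \<times> real \<Rightarrow> real) \<Rightarrow> 'a::real_normed_vector \<times> 'b::real_normed_vector \<Rightarrow> real" where
  "sum_norm F = (\<lambda>(x\<^sub>1, x\<^sub>2). F (norm x\<^sub>1, norm x\<^sub>2))"

text \<open>
  These sets are compact and contain \<open>0\<close>, so both suprema are maxima.
\<close>
definition xhat1 :: "(real \<times> real \<Rightarrow> real) \<Rightarrow> real" where
  "xhat1 F = Sup {y. (1, y) \<in> pos_sphere F}"

definition xhat2 :: "(real \<times> real \<Rightarrow> real) \<Rightarrow> real" where
  "xhat2 F = Sup {x. (x, 1) \<in> pos_sphere F}"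

definition corner1 :: "(real \<times> real \<Rightarrow> real) \<Rightarrow> real \<times> real" where
  "corner1 F = (1, xhat1 F)"

definition corner2 :: "(real \<times> real \<Rightarrow> real) \<Rightarrow> real \<times> real" where
  "corner2 F = (xhat2 F, 1)"

definition edges :: "'a::real_vector set \<Rightarrow> 'a set set" where
  "edges S = {E. (\<exists>p q. p \<noteq> q \<and> E = closed_segment p q) \<and> E \<subseteq> S \<and>
     (\<forall>p q. E \<subseteq> closed_segment p q \<and> closed_segment p q \<subseteq> S \<longrightarrow> closed_segment p q = E)}"

definition polygonal_arc :: "nat \<Rightarrow> 'a::real_normed_vector \<Rightarrow> 'a \<Rightarrow> 'a set \<Rightarrow> bool" where
  "polygonal_arc n p q S \<longleftrightarrow>
     (\<exists>g. arc g \<and> pathstart g = p \<and> pathfinish g = q \<and> path_image g = S) \<and>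
     S = \<Union>(edges S) \<and> finite (edges S) \<and> card (edges S) = n"

text \<open>\<open>lattice_family k n\<close> is \<open>\<F>\<^bsub>k,n\<^esub>\<close>, for \<open>k = n - 1\<close> and \<open>k = n\<close> only.\<close>
definition lattice_family :: "nat \<Rightarrow> nat \<Rightarrow> (real \<times> real \<Rightarrow> real) set" where
  "lattice_family k n = {F. two_dim_lattice F \<and> polygonal_arc n (1, 0) (0, 1) (pos_sphere F) \<and>
     ((Suc k = n \<and> xhat1 F > 0 \<and> xhat2 F > 0) \<or>
      (k = n \<and> (xhat1 F = 0 \<longleftrightarrow> xhat2 F \<noteq> 0)))}"

end

theory Submission
  imports Defs
begin

text \<open>
  Every \<open>a \<ge> 0\<close> satisfies \<open>max a\<^sub>1 a\<^sub>2 \<le> F a\<close> and \<open>f\<^sub>1 a\<^sub>1 + f\<^sub>2 a\<^sub>2 \<le> F a\<close>, so a functional on \<open>X \<oplus>\<^sub>F X\<close> whose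
  components have norms \<open>n\<^sub>1\<close>, \<open>n\<^sub>2\<close> has norm at most \<open>M = n\<^sub>1 c\<^sub>1 + n\<^sub>2 c\<^sub>2\<close> for one of the two corners \<open>c\<close>.
  For a rank-one operator given by such a functional and a unit vector \<open>e\<close>, choose unit vectors \<open>u\<close>
  and \<open>v\<close> that almost norm the components and satisfy
  \<open>\<parallel>M e + f\<^sub>1 c\<^sub>1 u\<parallel> \<approx> M + f\<^sub>1 c\<^sub>1\<close> and
  \<open>\<parallel>(M e + f\<^sub>1 c\<^sub>1 u) + f\<^sub>2 c\<^sub>2 v\<parallel> \<approx> M + f\<^sub>1 c\<^sub>1 + f\<^sub>2 c\<^sub>2 = M + 1\<close>; both exist by the Daugavet property.
  The vector \<open>(c\<^sub>1 u, c\<^sub>2 v)\<close> then shows that \<open>G\<close> plus the operator has norm at least \<open>1 + M\<close>.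
\<close>

subsection \<open>Operators and their norms\<close>

lemma norm_fun_eq_0_iff:
  assumes "norm_fun p"
  shows "p x = 0 \<longleftrightarrow> x = 0"
  using assms unfolding norm_fun_def by blast

lemma norm_fun_nonneg:
  assumes "norm_fun p"
  shows "0 \<le> p x"
proof -
  have "p 0 \<le> p x + p (- x)"
    using assms unfolding norm_fun_def by (metis add.right_inverse)
  moreover have "p (- x) = p x"
    using assms unfolding norm_fun_def by (metis abs_minus_cancel abs_one mult_1 scaleR_minus1_left)
  moreover have "p 0 = 0"
    using assms by (simp add: norm_fun_def)
  ultimately show ?thesis by simp
qed

text \<open>Where \<open>p x = 0\<close> the quotient is \<open>0\<close>, because division by zero
  gives \<open>0\<close>; the assumption \<open>0 \<le> K\<close> covers this value.\<close>

lemma onorm_wrt_le: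
  assumes "norm_fun p" "0 \<le> K" "\<And>x. q (T x) \<le> K * p x"
  shows "onorm_wrt p q T \<le> K"
  unfolding onorm_wrt_def
proof (rule cSUP_least)
  fix x
  show "q (T x) / p x \<le> K"
    using norm_fun_nonneg[OF assms(1), of x] assms(2) assms(3)[of x]
    by (cases "p x = 0") (auto simp: divide_simps)
qed simp

text \<open>Boundedness of \<open>T\<close> makes the quotients bounded above, so that
  \<open>SUP\<close> is a genuine least upper bound.\<close>

lemma le_onorm_wrt:
  assumes "norm_fun p" "norm_fun q" "bounded_linear_wrt p q T"
  shows "q (T x) \<le> onorm_wrt p q T * p x"
proof (cases "x = 0")
  case True
  then have "T x = 0"
    using assms(3) by (simp add: bounded_linear_wrt_def linear_0)
  moreover have "p 0 = 0" "q 0 = 0"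
    using assms(1,2) unfolding norm_fun_def by blast+
  ultimately show ?thesis
    using True by simp
next
  case False
  then have pos: "0 < p x"
    using norm_fun_nonneg[OF assms(1), of x] assms(1) by (simp add: norm_fun_def less_le)
  obtain K where K: "\<And>x. q (T x) \<le> p x * K"
    using assms(3) by (auto simp: bounded_linear_wrt_def)
  \<comment> \<open>The \<open>0\<close> in \<open>max 0 K\<close> serves the \<open>y\<close> with
    \<open>p y = 0\<close>, whose quotient is \<open>0\<close>.\<close>
  have "q (T y) / p y \<le> max 0 K" for y
  proof (cases "p y = 0")
    case False
    then have "0 < p y"
      using norm_fun_nonneg[OF assms(1), of y] by simp
    then have "q (T y) / p y \<le> K"
      using K[of y] by (simp add: divide_simps mult.commute)
    then show ?thesis by simp
  qed simp
  then have "bdd_above (range (\<lambda>y. q (T y) / p y))"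
    by (intro bdd_aboveI[of _ "max 0 K"]) auto
  then have "q (T x) / p x \<le> onorm_wrt p q T"
    unfolding onorm_wrt_def by (intro cSUP_upper) auto
  with pos show ?thesis by (simp add: divide_simps)
qed

lemma onorm_wrt_nonneg:
  assumes "norm_fun p" "norm_fun q" "bounded_linear_wrt p q T"
  shows "0 \<le> onorm_wrt p q T"
proof (cases "\<exists>x. p x \<noteq> 0")
  case True
  then obtain x where "p x \<noteq> 0" by blast
  moreover have "0 \<le> onorm_wrt p q T * p x"
    using le_onorm_wrt[OF assms, of x] norm_fun_nonneg[OF assms(2), of "T x"] by linarith
  ultimately show ?thesis
    using norm_fun_nonneg[OF assms(1), of x] by (simp add: zero_le_mult_iff)
next
  case False
  then show ?thesis by (simp add: onorm_wrt_def)
qed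

lemma onorm_wrt_triangle:
  assumes "norm_fun p" "norm_fun q" "bounded_linear_wrt p q S" "bounded_linear_wrt p q T"
  shows "onorm_wrt p q (\<lambda>x. S x + T x) \<le> onorm_wrt p q S + onorm_wrt p q T"
proof (rule onorm_wrt_le)
  show "0 \<le> onorm_wrt p q S + onorm_wrt p q T"
    using assms by (simp add: onorm_wrt_nonneg)
  fix x
  have "q (S x + T x) \<le> q (S x) + q (T x)"
    using assms(2) by (simp add: norm_fun_def)
  also have "\<dots> \<le> onorm_wrt p q S * p x + onorm_wrt p q T * p x"
    by (intro add_mono le_onorm_wrt assms)
  finally show "q (S x + T x) \<le> (onorm_wrt p q S + onorm_wrt p q T) * p x"
    by (simp add: algebra_simps)
qed (fact assms)

lemma bounded_linear_wrt_add:
  assumes "norm_fun q" "bounded_linear_wrt p q S" "bounded_linear_wrt p q T"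
  shows "bounded_linear_wrt p q (\<lambda>x. S x + T x)"
proof -
  obtain K L where *: "\<And>x. q (S x) \<le> p x * K" "\<And>x. q (T x) \<le> p x * L"
    using assms by (auto simp: bounded_linear_wrt_def)
  have "q (S x + T x) \<le> p x * (K + L)" for x
  proof -
    have "q (S x + T x) \<le> q (S x) + q (T x)"
      using assms(1) by (simp add: norm_fun_def)
    with *[of x] show ?thesis by (simp add: algebra_simps)
  qed
  then show ?thesis
    using assms(2,3) by (auto simp: bounded_linear_wrt_def intro: linear_compose_add)
qed

text \<open>A basis of the range is a single nonzero vector, and \<open>e\<close> is its
  normalisation. Coefficients of \<open>e\<close> are unique, which makes the coordinate
  \<open>\<phi>\<close> linear; since \<open>e\<close> is a unit vector, \<open>\<phi>\<close>
  carries the whole norm of \<open>T\<close>.\<close>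

lemma dim_range_one_imp_scaleR:
  fixes T :: "'a::real_vector \<Rightarrow> 'b::real_normed_vector"
  assumes "linear T" "dim (range T) = 1"
  obtains \<phi> e where "linear \<phi>" "norm e = 1" "\<And>x. T x = \<phi> x *\<^sub>R e"
proof -
  obtain B where B: "B \<subseteq> range T" "independent B" "range T \<subseteq> span B" "card B = dim (range T)"
    by (rule real_vector.basis_exists)
  then obtain b where b: "B = {b}"
    using assms(2) card_1_singletonE by metis
  with B have "b \<noteq> 0"
    using real_vector.dependent_zero by blast
  define e where "e = b /\<^sub>R norm b"
  have e: "norm e = 1"
    using \<open>b \<noteq> 0\<close> by (simp add: e_def)
  have "\<exists>c. T x = c *\<^sub>R e" for x
  proof -
    have "T x \<in> span {b}"
      using B b by blast
    then obtain k where "T x = k *\<^sub>R b"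
      by (auto simp: real_vector.span_singleton)
    then show ?thesis
      using \<open>b \<noteq> 0\<close> by (intro exI[of _ "k * norm b"]) (simp add: e_def)
  qed
  then obtain \<phi> where \<phi>: "\<And>x. T x = \<phi> x *\<^sub>R e"
    by metis
  have cancel: "c = d" if "c *\<^sub>R e = d *\<^sub>R e" for c d
    using that e by auto
  have "linear \<phi>"
  proof
    show "\<phi> (x + y) = \<phi> x + \<phi> y" for x y
      using linear_add[OF assms(1), of x y] by (intro cancel) (simp add: \<phi> scaleR_add_left)
    show "\<phi> (c *\<^sub>R x) = c *\<^sub>R \<phi> x" for c x
      using linear_scale[OF assms(1), of c x] by (intro cancel) (simp add: \<phi>)
  qed
  with e \<phi> that show ?thesis by blast
qed

text \<open>Supplies the operators to which the Daugavet property of the space is applied.\<close>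

lemma rank_one_operator_scaleR:
  assumes "bounded_linear \<phi>" "\<not> (\<forall>x. \<phi> x = 0)" "e \<noteq> 0"
  shows "rank_one_operator norm norm (\<lambda>x. \<phi> x *\<^sub>R e)"
proof -
  interpret \<phi>: bounded_linear \<phi> by fact
  obtain a where a: "\<phi> a \<noteq> 0"
    using assms(2) by blast
  have "range (\<lambda>x. \<phi> x *\<^sub>R e) = range (\<lambda>k. k *\<^sub>R e)"
  proof -
    have "k *\<^sub>R e = \<phi> ((k / \<phi> a) *\<^sub>R a) *\<^sub>R e" for k
      using a by (simp add: \<phi>.scaleR)
    then show ?thesis by blast
  qed
  also have "\<dots> = span {e}"
    by (simp add: real_vector.span_singleton)
  finally have "dim (range (\<lambda>x. \<phi> x *\<^sub>R e)) = 1"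
    using real_vector.dim_eq_card_independent[of "{e}"] assms(3) by simp
  moreover have "bounded_linear (\<lambda>x. \<phi> x *\<^sub>R e)"
    by (intro bounded_linear_compose[OF bounded_linear_scaleR_left] assms)
  ultimately show ?thesis
    by (simp add: rank_one_operator_def bounded_linear_wrt_norm)
qed

subsection \<open>Slices in spaces with the Daugavet property\<close>

text \<open>The operator \<open>T\<close> given by \<open>\<phi>\<close> and
  \<open>e /\<^sub>R onorm \<phi>\<close> has norm 1, so Id + \<open>T\<close> has norm 2. A
  normalised vector \<open>u\<close> that almost attains it gives a norm of
  \<open>u + s *\<^sub>R e\<close> close to 2, where \<open>s = \<phi> u / onorm \<phi>\<close>.
  Since \<open>s \<le> 1\<close>, this forces \<open>s\<close> to be close to 1, which yields both
  conclusions.\<close>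

lemma Daugavet_property_unit_slice:
  fixes \<phi> :: "'a::real_normed_vector \<Rightarrow> real"
  assumes D: "Daugavet_property (norm :: 'a \<Rightarrow> real)" and \<phi>: "bounded_linear \<phi>"
    and e: "norm e = 1" and "0 < \<epsilon>"
  obtains u where "norm u = 1" "onorm \<phi> - \<epsilon> \<le> \<phi> u" "2 - \<epsilon> \<le> norm (u + e)"
\<comment> \<open>For \<open>\<phi> = 0\<close> there is no rank-one operator to use, but
  \<open>u = e\<close> works.\<close>
proof (cases "\<forall>x. \<phi> x = 0")
  case True
  then have "onorm \<phi> = 0"
    using onorm_eq_0[OF \<phi>] by simp
  moreover have "norm (e + e) = 2"
    using e by (simp flip: scaleR_2)
  ultimately show ?thesis
    using that[of e] True e \<open>0 < \<epsilon>\<close> by auto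
next
  case False
  interpret \<phi>: bounded_linear \<phi> by fact
  define N where "N = onorm \<phi>"
  have "0 < N"
    using False onorm_pos_lt[OF \<phi>] by (simp add: N_def)
  define T where "T x = \<phi> x *\<^sub>R (e /\<^sub>R N)" for x
  have "e \<noteq> 0" using e by auto
  then have "rank_one_operator norm norm T"
    using rank_one_operator_scaleR[OF \<phi> False, of "e /\<^sub>R N"] \<open>0 < N\<close> by (simp add: T_def[abs_def])
  then have "onorm (\<lambda>x. x + T x) = onorm (\<lambda>x::'a. x) + onorm T"
    using D by (simp add: Daugavet_property_def Daugavet_center_def onorm_wrt_norm)
  moreover have "onorm T = 1"
    using onorm_scaleR_left[OF \<phi>, of "e /\<^sub>R N"] \<open>0 < N\<close> e by (simp add: T_def[abs_def] N_def)
  moreover have "1 \<le> onorm (\<lambda>x::'a. x)"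
    using onorm[OF bounded_linear_ident, of e] e by simp
  ultimately have two: "2 \<le> onorm (\<lambda>x. x + T x)"
    by simp
  \<comment> \<open>The three bounds serve the slice condition, the norm of \<open>u + e\<close>,
    and the inequality \<open>0 \<le> 2 - \<delta>\<close> required for the operator norm
    bound.\<close>
  define \<delta> where "\<delta> = min (min (\<epsilon> / N) (\<epsilon> / 2)) 1"
  have \<delta>: "0 < \<delta>" "\<delta> * N \<le> \<epsilon>" "2 * \<delta> \<le> \<epsilon>" "\<delta> \<le> 1"
    using \<open>0 < N\<close> \<open>0 < \<epsilon>\<close> by (auto simp: \<delta>_def min_def field_simps)
  have "\<exists>x. (2 - \<delta>) * norm x < norm (x + T x)"
  proof (rule ccontr)
    assume "\<not> ?thesis"
    then have "onorm (\<lambda>x. x + T x) \<le> 2 - \<delta>"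
      using \<delta> by (intro onorm_bound) (auto simp: not_less)
    with two \<delta> show False by simp
  qed
  then obtain x where x: "(2 - \<delta>) * norm x < norm (x + T x)" by blast
  then have "x \<noteq> 0" by (auto simp: T_def)
  \<comment> \<open>Besides normalising \<open>x\<close>, the factor \<open>\<sigma>\<close> fixes
    the sign of \<open>\<phi> u\<close>, so that \<open>T u\<close> is a nonnegative multiple of
    \<open>e\<close>.\<close>
  define \<sigma> where "\<sigma> = (if 0 \<le> \<phi> x then 1 else - 1 :: real) / norm x"
  define u where "u = \<sigma> *\<^sub>R x"
  have \<sigma>: "\<bar>\<sigma>\<bar> * norm x = 1"
    using \<open>x \<noteq> 0\<close> by (simp add: \<sigma>_def)
  have u: "norm u = 1"
    using \<sigma> by (simp add: u_def)
  have "0 \<le> \<phi> u"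
    using \<open>x \<noteq> 0\<close> by (auto simp: u_def \<phi>.scaleR \<sigma>_def zero_le_mult_iff zero_le_divide_iff divide_le_0_iff)
  define s where "s = \<phi> u / N"
  have s: "0 \<le> s" "s \<le> 1"
    using \<open>0 \<le> \<phi> u\<close> \<open>0 < N\<close> onorm[OF \<phi>, of u] u by (auto simp: s_def N_def)
  have "u + s *\<^sub>R e = \<sigma> *\<^sub>R (x + T x)"
    using \<open>0 < N\<close> by (simp add: u_def s_def T_def \<phi>.scaleR scaleR_add_right divide_inverse mult.assoc)
  then have "norm (u + s *\<^sub>R e) = \<bar>\<sigma>\<bar> * norm (x + T x)"
    by simp
  moreover have "\<bar>\<sigma>\<bar> * ((2 - \<delta>) * norm x) < \<bar>\<sigma>\<bar> * norm (x + T x)"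
    using x \<sigma> by (intro mult_strict_left_mono) (auto simp: zero_less_mult_iff)
  moreover have "\<bar>\<sigma>\<bar> * ((2 - \<delta>) * norm x) = 2 - \<delta>"
    using \<sigma> by (metis mult.left_commute mult.right_neutral)
  ultimately have big: "2 - \<delta> < norm (u + s *\<^sub>R e)"
    by simp
  have "norm (u + s *\<^sub>R e) \<le> 1 + s"
    using norm_triangle_ineq[of u "s *\<^sub>R e"] u e s by simp
  with big have s1: "1 - \<delta> < s" by simp
  then have "N - \<epsilon> \<le> \<phi> u"
    using \<open>0 < N\<close> \<delta>(2) by (simp add: s_def field_simps)
  moreover have "2 - \<epsilon> \<le> norm (u + e)"
  proof -
    \<comment> \<open>Replacing \<open>s *\<^sub>R e\<close> by \<open>e\<close> costs at most
      \<open>1 - s < \<delta>\<close>, on top of the \<open>\<delta>\<close> already lost; hence the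
      bound \<open>2 * \<delta> \<le> \<epsilon>\<close>.\<close>
    have eq: "u + s *\<^sub>R e = (u + e) - (1 - s) *\<^sub>R e"
      by (simp add: algebra_simps)
    have "norm (u + s *\<^sub>R e) \<le> norm (u + e) + (1 - s)"
      unfolding eq using norm_triangle_ineq4[of "u + e" "(1 - s) *\<^sub>R e"] e s by simp
    with big s1 \<delta>(3) show ?thesis by simp
  qed
  ultimately show ?thesis
    using that u by (simp add: N_def)
qed

text \<open>Scale \<open>u + e\<close> by the larger coefficient \<open>t\<close>; the surplus
  \<open>(t - s) *\<^sub>R u\<close> has norm \<open>t - s\<close>, and
  \<open>t * (2 - \<epsilon>) - (t - s)\<close> is the bound.\<close>

lemma norm_add_unit_scaleR_ge:
  fixes u e :: "'a::real_normed_vector"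
  assumes "norm u = 1" "norm e = 1" "2 - \<epsilon> \<le> norm (u + e)" "0 \<le> s" "s \<le> t"
  shows "s + t - t * \<epsilon> \<le> norm (s *\<^sub>R u + t *\<^sub>R e)"
proof -
  have "t *\<^sub>R (u + e) = (s *\<^sub>R u + t *\<^sub>R e) + (t - s) *\<^sub>R u"
    by (simp add: algebra_simps)
  then have "t * norm (u + e) \<le> norm (s *\<^sub>R u + t *\<^sub>R e) + (t - s)"
    using norm_triangle_ineq[of "s *\<^sub>R u + t *\<^sub>R e" "(t - s) *\<^sub>R u"] assms
    by (metis abs_of_nonneg diff_ge_0_iff_ge mult.right_neutral norm_scaleR order_trans)
  moreover have "t * (2 - \<epsilon>) \<le> t * norm (u + e)"
    using assms by (intro mult_left_mono) auto
  ultimately show ?thesis by (simp add: algebra_simps)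
qed

text \<open>The unit version is applied in the direction \<open>e\<close> of \<open>z\<close>.
  Near-additivity of the norm on \<open>u\<close> and \<open>e\<close> passes to nonnegative
  multiples, the larger of \<open>t\<close> and \<open>norm z\<close> being the scaling
  factor.\<close>

lemma Daugavet_property_slice:
  fixes \<phi> :: "'a::real_normed_vector \<Rightarrow> real"
  assumes D: "Daugavet_property (norm :: 'a \<Rightarrow> real)" and \<phi>: "bounded_linear \<phi>"
    and "0 \<le> t" and "0 < \<epsilon>"
  obtains u where "norm u = 1" "onorm \<phi> - \<epsilon> \<le> \<phi> u" "norm z + t - \<epsilon> \<le> norm (z + t *\<^sub>R u)"
proof -
  obtain x0 :: 'a where "x0 \<noteq> 0"
    using D by (auto simp: Daugavet_property_def Daugavet_center_def)
  \<comment> \<open>If \<open>z = 0\<close>, any unit vector may stand for its direction.\<close>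
  obtain e where e: "norm e = 1" "norm z *\<^sub>R e = z"
  proof (cases "z = 0")
    case True
    then show ?thesis
      using that[of "x0 /\<^sub>R norm x0"] \<open>x0 \<noteq> 0\<close> by simp
  next
    case False
    then show ?thesis
      using that[of "z /\<^sub>R norm z"] by simp
  qed
  \<comment> \<open>Chosen so that \<open>\<delta>\<close> multiplied by \<open>1\<close>, by
    \<open>norm z\<close> or by \<open>t\<close> stays within \<open>\<epsilon>\<close>.\<close>
  define \<delta> where "\<delta> = \<epsilon> / (1 + norm z + t)"
  have pos: "0 < 1 + norm z + t"
    using \<open>0 \<le> t\<close> by (simp add: add_pos_nonneg)
  then have "0 < \<delta>"
    using \<open>0 < \<epsilon>\<close> by (simp add: \<delta>_def)
  have \<delta>: "\<delta> * c \<le> \<epsilon>" if "c \<le> 1 + norm z + t" for c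
  proof -
    have "\<delta> * c \<le> \<delta> * (1 + norm z + t)"
      using that \<open>0 < \<delta>\<close> by (intro mult_left_mono) auto
    also have "\<dots> = \<epsilon>"
      using pos by (simp add: \<delta>_def)
    finally show ?thesis .
  qed
  obtain u where u: "norm u = 1" "onorm \<phi> - \<delta> \<le> \<phi> u" "2 - \<delta> \<le> norm (u + e)"
    using Daugavet_property_unit_slice[OF D \<phi> e(1) \<open>0 < \<delta>\<close>] by blast
  have "norm z + t - \<epsilon> \<le> norm (norm z *\<^sub>R e + t *\<^sub>R u)"
  proof (cases "t \<le> norm z")
    case True
    then show ?thesis
      using norm_add_unit_scaleR_ge[OF u(1) e(1) u(3) \<open>0 \<le> t\<close> True] \<delta>[of "norm z"] \<open>0 \<le> t\<close>
      by (simp add: add.commute mult.commute)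
  next
    case False
    then have "norm z \<le> t" by simp
    then show ?thesis
      using norm_add_unit_scaleR_ge[OF e(1) u(1) _ norm_ge_zero, of \<delta> z t] \<delta>[of t] u(3)
      by (simp add: add.commute mult.commute)
  qed
  moreover have "onorm \<phi> - \<epsilon> \<le> \<phi> u"
    using u(2) \<delta>[of 1] \<open>0 \<le> t\<close> by simp
  ultimately show ?thesis
    using that u(1) e(2) by simp
qed

subsection \<open>Two-dimensional lattices\<close>

lemma two_dim_lattice_norm_fun: "two_dim_lattice F \<Longrightarrow> norm_fun F"
  by (simp add: two_dim_lattice_def)

text \<open>Transfers facts about the first coordinate to the second.\<close>

lemma two_dim_lattice_swap:
  assumes "two_dim_lattice F"
  shows "two_dim_lattice (F \<circ> prod.swap)"
proof -
  have "norm_fun (F \<circ> prod.swap)"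
    using assms unfolding two_dim_lattice_def norm_fun_def
    by (auto simp: prod.swap_def zero_prod_def)
  moreover have "F (b, a) = F (\<bar>b\<bar>, \<bar>a\<bar>)" for a b
    using assms by (auto simp: two_dim_lattice_def)
  ultimately show ?thesis
    using assms by (simp add: two_dim_lattice_def)
qed

text \<open>The point \<open>(a, b)\<close> is a convex combination of \<open>(a', b)\<close> and
  its reflection \<open>(- a', b)\<close>, which have the same norm.\<close>

lemma two_dim_lattice_mono_fst:
  assumes F: "two_dim_lattice F" and a: "0 \<le> a" "a \<le> a'"
  shows "F (a, b) \<le> F (a', b)"
proof (cases "a' = 0")
  case True
  with a show ?thesis by simp
next
  case False
  \<comment> \<open>The solution of \<open>t * a' - (1 - t) * a' = a\<close>.\<close>
  define t where "t = (1 + a / a') / 2"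
  have t: "0 \<le> t" "t \<le> 1"
    using a False by (auto simp: t_def field_simps)
  have "(a, b) = t *\<^sub>R (a', b) + (1 - t) *\<^sub>R (- a', b)"
    using False by (simp add: t_def field_simps)
  then have "F (a, b) \<le> F (t *\<^sub>R (a', b)) + F ((1 - t) *\<^sub>R (- a', b))"
    using F by (metis two_dim_lattice_def norm_fun_def)
  also have "\<dots> = \<bar>t\<bar> * F (a', b) + \<bar>1 - t\<bar> * F (- a', b)"
    using F unfolding two_dim_lattice_def norm_fun_def by metis
  also have "F (- a', b) = F (a', b)"
    using F unfolding two_dim_lattice_def by (metis abs_minus_cancel)
  finally show ?thesis
    using t by (simp add: algebra_simps)
qed

lemma two_dim_lattice_mono:
  assumes F: "two_dim_lattice F" and "0 \<le> a" "a \<le> a'" "0 \<le> b" "b \<le> b'"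
  shows "F (a, b) \<le> F (a', b')"
proof -
  have "F (a, b) \<le> F (a', b)"
    by (intro two_dim_lattice_mono_fst assms)
  also have "\<dots> \<le> F (a', b')"
    using two_dim_lattice_mono_fst[OF two_dim_lattice_swap[OF F], of b b' a'] assms by simp
  finally show ?thesis .
qed

lemma two_dim_lattice_axis:
  assumes F: "two_dim_lattice F"
  shows "F (a, 0) = \<bar>a\<bar>" "F (0, a) = \<bar>a\<bar>"
proof -
  have "F (a *\<^sub>R x) = \<bar>a\<bar> * F x" for x
    using two_dim_lattice_norm_fun[OF F] unfolding norm_fun_def by blast
  from this[of "(1, 0)"] this[of "(0, 1)"] show "F (a, 0) = \<bar>a\<bar>" "F (0, a) = \<bar>a\<bar>"
    using F by (simp_all add: two_dim_lattice_def)
qed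

lemma two_dim_lattice_abs_le:
  assumes F: "two_dim_lattice F"
  shows "\<bar>a\<bar> \<le> F (a, b)" "\<bar>b\<bar> \<le> F (a, b)"
proof -
  have "F (a, b) = F (\<bar>a\<bar>, \<bar>b\<bar>)"
    using F by (simp add: two_dim_lattice_def)
  then show "\<bar>a\<bar> \<le> F (a, b)" "\<bar>b\<bar> \<le> F (a, b)"
    using two_dim_lattice_mono[OF F, of "\<bar>a\<bar>" "\<bar>a\<bar>" 0 "\<bar>b\<bar>"]
      two_dim_lattice_mono[OF F, of 0 "\<bar>a\<bar>" "\<bar>b\<bar>" "\<bar>b\<bar>"]
    by (simp_all add: two_dim_lattice_axis[OF F])
qed

lemma two_dim_lattice_add_le:
  assumes F: "two_dim_lattice F"
  shows "F (a + c, b + d) \<le> F (a, b) + F (c, d)"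
proof -
  have "F ((a, b) + (c, d)) \<le> F (a, b) + F (c, d)"
    using two_dim_lattice_norm_fun[OF F] unfolding norm_fun_def by blast
  then show ?thesis by simp
qed

lemma two_dim_lattice_le_sum:
  assumes F: "two_dim_lattice F"
  shows "F (a, b) \<le> \<bar>a\<bar> + \<bar>b\<bar>"
  using two_dim_lattice_add_le[OF F, of a 0 0 b] by (simp add: two_dim_lattice_axis[OF F])

text \<open>The supremum is attained: some admissible \<open>y\<close> lies within any \<epsilon>
  below it, and raising the second coordinate from \<open>y\<close> to \<open>xhat1 F\<close>
  increases \<open>F\<close> by at most \<epsilon>. The reverse estimate is domination of the first
  coordinate by \<open>F\<close>.\<close>

lemma pos_sphere_xhat1:
  assumes F: "two_dim_lattice F"
  shows "(1, xhat1 F) \<in> pos_sphere F" "xhat1 F \<le> 1"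
proof -
  let ?Y = "{y. (1, y) \<in> pos_sphere F}"
  have le1: "y \<le> 1" if "y \<in> ?Y" for y
    using that two_dim_lattice_abs_le(2)[OF F, of y 1] by (auto simp: pos_sphere_def)
  have zero: "0 \<in> ?Y"
    using F by (simp add: two_dim_lattice_def pos_sphere_def)
  have bdd: "bdd_above ?Y"
    using le1 by (intro bdd_aboveI[of _ 1])
  have nonneg: "0 \<le> xhat1 F"
    unfolding xhat1_def by (intro cSup_upper zero bdd)
  show "xhat1 F \<le> 1"
    unfolding xhat1_def using zero le1 by (intro cSup_least) auto
  have "F (1, xhat1 F) \<le> 1 + \<epsilon>" if "0 < \<epsilon>" for \<epsilon>
  proof -
    obtain y where y: "y \<in> ?Y" "xhat1 F - \<epsilon> < y"
      using less_cSupD[of ?Y "xhat1 F - \<epsilon>"] zero \<open>0 < \<epsilon>\<close> unfolding xhat1_def by auto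
    then have "y \<le> xhat1 F"
      unfolding xhat1_def by (intro cSup_upper bdd)
    with y show ?thesis
      using two_dim_lattice_add_le[OF F, of 1 0 y "xhat1 F - y"]
      by (simp add: two_dim_lattice_axis[OF F] pos_sphere_def)
  qed
  then have "F (1, xhat1 F) \<le> 1"
    by (rule field_le_epsilon)
  moreover have "1 \<le> F (1, xhat1 F)"
    using two_dim_lattice_abs_le(1)[OF F, of 1 "xhat1 F"] by simp
  ultimately show "(1, xhat1 F) \<in> pos_sphere F"
    using nonneg by (simp add: pos_sphere_def)
qed

lemma pos_sphere_xhat2:
  assumes F: "two_dim_lattice F"
  shows "(xhat2 F, 1) \<in> pos_sphere F" "xhat2 F \<le> 1"
proof -
  have "xhat2 F = xhat1 (F \<circ> prod.swap)"
    by (simp add: xhat1_def xhat2_def pos_sphere_def conj_commute)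
  then show "(xhat2 F, 1) \<in> pos_sphere F" "xhat2 F \<le> 1"
    using pos_sphere_xhat1[OF two_dim_lattice_swap[OF F]] by (auto simp: pos_sphere_def)
qed

text \<open>Dividing \<open>(a, b)\<close> by its norm gives a point of the unit ball, where the
  supremum applies. It is a supremum of a bounded set because the unit ball lies in the square
  \<open>[-1, 1]\<close> x \<open>[-1, 1]\<close>.\<close>

lemma dual_lattice_pairing_le:
  assumes F: "two_dim_lattice F"
  shows "\<bar>f * a + g * b\<bar> \<le> dual_lattice F (f, g) * F (a, b)"
proof (cases "(a, b) = 0")
  case True
  then show ?thesis
    using norm_fun_eq_0_iff[OF two_dim_lattice_norm_fun[OF F], of "(a, b)"] by (simp add: zero_prod_def)
next
  case False
  let ?S = "{\<bar>f * a + g * b\<bar> | a b. F (a, b) \<le> 1}"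
  define r where "r = F (a, b)"
  have "0 < r"
    using False norm_fun_nonneg[of F "(a, b)"] norm_fun_eq_0_iff[of F "(a, b)"]
      two_dim_lattice_norm_fun[OF F]
    by (simp add: r_def less_le)
  have "s \<le> \<bar>f\<bar> + \<bar>g\<bar>" if "s \<in> ?S" for s
  proof -
    from that obtain a b where s: "s = \<bar>f * a + g * b\<bar>" and "F (a, b) \<le> 1"
      by blast
    then have "\<bar>a\<bar> \<le> 1" "\<bar>b\<bar> \<le> 1"
      using two_dim_lattice_abs_le[OF F, where a = a and b = b] by linarith+
    then have "\<bar>f\<bar> * \<bar>a\<bar> \<le> \<bar>f\<bar>" "\<bar>g\<bar> * \<bar>b\<bar> \<le> \<bar>g\<bar>"
      by (simp_all add: mult_left_le)
    with s show ?thesis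
      using abs_triangle_ineq[of "f * a" "g * b"] by (simp add: abs_mult)
  qed
  then have bdd: "bdd_above ?S"
    by (intro bdd_aboveI)
  have "F ((1 / r) *\<^sub>R (a, b)) = \<bar>1 / r\<bar> * r"
    using F unfolding two_dim_lattice_def norm_fun_def r_def by blast
  then have "F (a / r, b / r) = 1"
    using \<open>0 < r\<close> by simp
  then have "\<bar>f * (a / r) + g * (b / r)\<bar> \<le> Sup ?S"
    by (intro cSup_upper bdd CollectI exI[of _ "a / r"] exI[of _ "b / r"]) simp
  moreover have "\<bar>f * (a / r) + g * (b / r)\<bar> = \<bar>f * a + g * b\<bar> / r"
    using \<open>0 < r\<close> by (simp flip: add_divide_distrib)
  ultimately show ?thesis
    using \<open>0 < r\<close> by (simp add: dual_lattice_def r_def divide_simps)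
qed

section \<open>The norm of the direct sum and its completeness\<close>

lemma norm_fun_sum_norm:
  assumes F: "two_dim_lattice F"
  shows "norm_fun (sum_norm F :: 'a::real_normed_vector \<times> 'b::real_normed_vector \<Rightarrow> real)"
  unfolding norm_fun_def
proof (intro conjI allI)
  fix x y :: "'a \<times> 'b" and c :: real
  obtain x1 x2 y1 y2 where xy: "x = (x1, x2)" "y = (y1, y2)"
    by (cases x, cases y)
  show "sum_norm F x = 0 \<longleftrightarrow> x = 0"
    using F by (auto simp: xy sum_norm_def two_dim_lattice_def norm_fun_def zero_prod_def)
  \<comment> \<open>The componentwise triangle inequalities pass through \<open>F\<close> because
    \<open>F\<close> is monotone on the positive quadrant.\<close>
  have "F (norm (x1 + y1), norm (x2 + y2)) \<le> F (norm x1 + norm y1, norm x2 + norm y2)"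
    by (intro two_dim_lattice_mono F norm_triangle_ineq norm_ge_zero)
  also have "\<dots> \<le> F (norm x1, norm x2) + F (norm y1, norm y2)"
    by (rule two_dim_lattice_add_le[OF F])
  finally show "sum_norm F (x + y) \<le> sum_norm F x + sum_norm F y"
    by (simp add: xy sum_norm_def)
  have "F (\<bar>c\<bar> *\<^sub>R (norm x1, norm x2)) = \<bar>\<bar>c\<bar>\<bar> * F (norm x1, norm x2)"
    using F unfolding two_dim_lattice_def norm_fun_def by blast
  then show "sum_norm F (c *\<^sub>R x) = \<bar>c\<bar> * sum_norm F x"
    by (simp add: xy sum_norm_def)
qed

lemma norm_le_sum_norm:
  assumes F: "two_dim_lattice F"
  shows "norm (fst x) \<le> sum_norm F x" "norm (snd x) \<le> sum_norm F x"
  using two_dim_lattice_abs_le[OF F, where a = "norm (fst x)" and b = "norm (snd x)"]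
  by (simp_all add: sum_norm_def case_prod_beta)

lemma sum_norm_le:
  assumes F: "two_dim_lattice F"
  shows "sum_norm F x \<le> norm (fst x) + norm (snd x)"
  using two_dim_lattice_le_sum[OF F, of "norm (fst x)" "norm (snd x)"]
  by (simp add: sum_norm_def case_prod_beta)

text \<open>The sum norm dominates both component norms, so Cauchy sequences are Cauchy in each
  component; it is at most the sum of the component norms, so componentwise limits are
  limits.\<close>

lemma banach_norm_sum_norm:
  assumes F: "two_dim_lattice F"
  shows "banach_norm (sum_norm F :: 'a::banach \<times> 'b::banach \<Rightarrow> real)"
proof -
  let ?p = "sum_norm F :: 'a \<times> 'b \<Rightarrow> real"
  note p = norm_fun_sum_norm[OF F, where 'a = 'a and 'b = 'b]
  interpret Metric_space UNIV "\<lambda>x y. ?p (x - y)"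
  proof
    fix x y z :: "'a \<times> 'b"
    show "0 \<le> ?p (x - y)"
      by (rule norm_fun_nonneg[OF p])
    have "?p ((- 1) *\<^sub>R (x - y)) = \<bar>- 1\<bar> * ?p (x - y)"
      using p unfolding norm_fun_def by blast
    then show "?p (x - y) = ?p (y - x)"
      by simp
    show "?p (x - y) = 0 \<longleftrightarrow> x = y"
      using norm_fun_eq_0_iff[OF p, of "x - y"] by simp
    have "?p ((x - y) + (y - z)) \<le> ?p (x - y) + ?p (y - z)"
      using p unfolding norm_fun_def by blast
    then show "?p (x - z) \<le> ?p (x - y) + ?p (y - z)"
      by simp
  qed
  have "mcomplete"
    unfolding mcomplete_def
  proof (intro allI impI)
    fix \<sigma> :: "nat \<Rightarrow> 'a \<times> 'b"
    assume "MCauchy \<sigma>"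
    then have C: "\<exists>N. \<forall>m n. N \<le> m \<longrightarrow> N \<le> n \<longrightarrow> ?p (\<sigma> m - \<sigma> n) < \<epsilon>" if "0 < \<epsilon>" for \<epsilon>
      using that by (auto simp: MCauchy_def)
    have le: "norm (fst (\<sigma> m) - fst (\<sigma> n)) \<le> ?p (\<sigma> m - \<sigma> n)"
      "norm (snd (\<sigma> m) - snd (\<sigma> n)) \<le> ?p (\<sigma> m - \<sigma> n)" for m n
      using norm_le_sum_norm[OF F, of "\<sigma> m - \<sigma> n"] by simp_all
    have "Cauchy (fst \<circ> \<sigma>)" "Cauchy (snd \<circ> \<sigma>)"
      unfolding Cauchy_iff o_def using C le by (meson le_less_trans)+
    then obtain l1 l2 where l: "(fst \<circ> \<sigma>) \<longlonglongrightarrow> l1" "(snd \<circ> \<sigma>) \<longlonglongrightarrow> l2"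
      by (meson Cauchy_convergent convergentD)
    have "(\<lambda>n. norm (fst (\<sigma> n) - l1) + norm (snd (\<sigma> n) - l2)) \<longlonglongrightarrow> 0 + 0"
      using l by (intro tendsto_add) (auto simp: o_def LIM_zero tendsto_norm_zero)
    then have "(\<lambda>n. ?p (\<sigma> n - (l1, l2))) \<longlonglongrightarrow> 0"
      by (rule metric_tendsto_imp_tendsto)
        (use norm_fun_nonneg[OF p] sum_norm_le[OF F, of "\<sigma> n - (l1, l2)" for n] in
          \<open>auto simp: abs_of_nonneg\<close>)
    then have "limitin mtopology \<sigma> (l1, l2) sequentially"
      by (simp add: limitin_metric_dist_null)
    then show "\<exists>l. limitin mtopology \<sigma> l sequentially" ..
  qed
  with p show ?thesis by (simp add: banach_norm_def)
qed

subsection \<open>Norms at the corners of the unit ball\<close>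

text \<open>
  Linear programming on \<open>0 \<le> b \<le> r\<close>, \<open>f\<^sub>1 b\<^sub>1 + f\<^sub>2 b\<^sub>2 \<le> r\<close>, whose relevant vertices are
  \<open>r (1, x\<^sub>1)\<close> and \<open>r (x\<^sub>2, 1)\<close>. If \<open>f\<^sub>1 = 0\<close> or \<open>f\<^sub>2 = 0\<close>, the vertex is \<open>r (1, 1)\<close>.
\<close>
lemma weighted_sum_le_corner_max:
  fixes f\<^sub>1 f\<^sub>2 n\<^sub>1 n\<^sub>2 x\<^sub>1 x\<^sub>2 b\<^sub>1 b\<^sub>2 r :: real
  assumes f: "0 \<le> f\<^sub>1" "0 \<le> f\<^sub>2" and n: "0 \<le> n\<^sub>1" "0 \<le> n\<^sub>2"
    and x: "f\<^sub>1 + f\<^sub>2 * x\<^sub>1 = 1" "f\<^sub>1 * x\<^sub>2 + f\<^sub>2 = 1" "x\<^sub>1 \<le> 1" "x\<^sub>2 \<le> 1"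
    and b: "0 \<le> b\<^sub>1" "b\<^sub>1 \<le> r" "0 \<le> b\<^sub>2" "b\<^sub>2 \<le> r" "f\<^sub>1 * b\<^sub>1 + f\<^sub>2 * b\<^sub>2 \<le> r"
  shows "n\<^sub>1 * b\<^sub>1 + n\<^sub>2 * b\<^sub>2 \<le> max (n\<^sub>1 + n\<^sub>2 * x\<^sub>1) (n\<^sub>1 * x\<^sub>2 + n\<^sub>2) * r"
proof -
  \<comment> \<open>A duality certificate: \<open>g\<^sub>2\<close> times the objective combines the
    constraints \<open>g\<^sub>1 * d\<^sub>1 + g\<^sub>2 * d\<^sub>2 \<le> r\<close> and
    \<open>d\<^sub>1 \<le> r\<close> with the nonnegative multipliers \<open>m\<^sub>2\<close> and
    \<open>m\<^sub>1 * g\<^sub>2 - m\<^sub>2 * g\<^sub>1\<close>.\<close>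
  have key: "m\<^sub>1 * d\<^sub>1 + m\<^sub>2 * d\<^sub>2 \<le> (m\<^sub>1 + m\<^sub>2 * y) * r"
    if "0 < g\<^sub>2" "0 \<le> m\<^sub>2" "m\<^sub>2 * g\<^sub>1 \<le> m\<^sub>1 * g\<^sub>2" "g\<^sub>1 + g\<^sub>2 * y = 1" "d\<^sub>1 \<le> r" "g\<^sub>1 * d\<^sub>1 + g\<^sub>2 * d\<^sub>2 \<le> r"
    for g\<^sub>1 g\<^sub>2 m\<^sub>1 m\<^sub>2 d\<^sub>1 d\<^sub>2 y :: real
  proof -
    have "g\<^sub>2 * (m\<^sub>1 * d\<^sub>1 + m\<^sub>2 * d\<^sub>2) = m\<^sub>2 * (g\<^sub>1 * d\<^sub>1 + g\<^sub>2 * d\<^sub>2) + (m\<^sub>1 * g\<^sub>2 - m\<^sub>2 * g\<^sub>1) * d\<^sub>1"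
      by (simp add: algebra_simps)
    also have "\<dots> \<le> m\<^sub>2 * r + (m\<^sub>1 * g\<^sub>2 - m\<^sub>2 * g\<^sub>1) * r"
      using that by (intro add_mono mult_left_mono) auto
    also have "\<dots> = m\<^sub>2 * (g\<^sub>1 + g\<^sub>2 * y) * r + (m\<^sub>1 * g\<^sub>2 - m\<^sub>2 * g\<^sub>1) * r"
      by (simp add: that(4))
    also have "\<dots> = g\<^sub>2 * ((m\<^sub>1 + m\<^sub>2 * y) * r)"
      by (simp add: algebra_simps)
    finally show ?thesis
      using \<open>0 < g\<^sub>2\<close> by simp
  qed
  have "0 \<le> r" using b by simp
  \<comment> \<open>Comparing the slopes of the objective and of the line decides which corner is
    optimal.\<close>
  consider "n\<^sub>2 * f\<^sub>1 \<le> n\<^sub>1 * f\<^sub>2" "0 < f\<^sub>2" | "n\<^sub>1 * f\<^sub>2 \<le> n\<^sub>2 * f\<^sub>1" "0 < f\<^sub>1"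
    | "f\<^sub>1 = 0" | "f\<^sub>2 = 0"
    using f by linarith
  then show ?thesis
  proof cases
    case 1
    then have "n\<^sub>1 * b\<^sub>1 + n\<^sub>2 * b\<^sub>2 \<le> (n\<^sub>1 + n\<^sub>2 * x\<^sub>1) * r"
      using key[of f\<^sub>2 n\<^sub>2 f\<^sub>1 n\<^sub>1 x\<^sub>1 b\<^sub>1 b\<^sub>2] n x b by simp
    also have "\<dots> \<le> max (n\<^sub>1 + n\<^sub>2 * x\<^sub>1) (n\<^sub>1 * x\<^sub>2 + n\<^sub>2) * r"
      using \<open>0 \<le> r\<close> by (intro mult_right_mono) auto
    finally show ?thesis .
  next
    case 2
    then have "n\<^sub>2 * b\<^sub>2 + n\<^sub>1 * b\<^sub>1 \<le> (n\<^sub>2 + n\<^sub>1 * x\<^sub>2) * r"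
      using key[of f\<^sub>1 n\<^sub>1 f\<^sub>2 n\<^sub>2 x\<^sub>2 b\<^sub>2 b\<^sub>1] n x b by (simp add: add.commute)
    also have "\<dots> \<le> max (n\<^sub>1 + n\<^sub>2 * x\<^sub>1) (n\<^sub>1 * x\<^sub>2 + n\<^sub>2) * r"
      using \<open>0 \<le> r\<close> by (intro mult_right_mono) auto
    finally show ?thesis by simp
  next
    case 3
    then have "x\<^sub>1 = 1" using x by auto
    have "n\<^sub>1 * b\<^sub>1 + n\<^sub>2 * b\<^sub>2 \<le> n\<^sub>1 * r + n\<^sub>2 * r"
      using n b by (intro add_mono mult_left_mono) auto
    also have "\<dots> \<le> max (n\<^sub>1 + n\<^sub>2 * x\<^sub>1) (n\<^sub>1 * x\<^sub>2 + n\<^sub>2) * r"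
      using \<open>0 \<le> r\<close> \<open>x\<^sub>1 = 1\<close> by (simp flip: distrib_right add: mult_right_mono)
    finally show ?thesis .
  next
    case 4
    then have "x\<^sub>2 = 1" using x by auto
    have "n\<^sub>1 * b\<^sub>1 + n\<^sub>2 * b\<^sub>2 \<le> n\<^sub>1 * r + n\<^sub>2 * r"
      using n b by (intro add_mono mult_left_mono) auto
    also have "\<dots> \<le> max (n\<^sub>1 + n\<^sub>2 * x\<^sub>1) (n\<^sub>1 * x\<^sub>2 + n\<^sub>2) * r"
      using \<open>0 \<le> r\<close> \<open>x\<^sub>2 = 1\<close> by (simp flip: distrib_right add: mult_right_mono)
    finally show ?thesis .
  qed
qed

text \<open>The vector \<open>u\<close> is chosen relative to \<open>M *\<^sub>R e\<close>, and
  \<open>v\<close> afterwards relative to the sum \<open>z\<close> already built, so that the norms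
  of all three summands add up almost exactly. The argument applies to any point of the positive
  sphere on the line.\<close>

lemma onorm_wrt_corner_ge:
  fixes \<phi>\<^sub>1 \<phi>\<^sub>2 :: "'a::real_normed_vector \<Rightarrow> real" and e :: 'a
  assumes D: "Daugavet_property (norm :: 'a \<Rightarrow> real)" and F: "two_dim_lattice F"
    and c: "(c\<^sub>1, c\<^sub>2) \<in> pos_sphere F" and f: "0 \<le> f\<^sub>1" "0 \<le> f\<^sub>2" "f\<^sub>1 * c\<^sub>1 + f\<^sub>2 * c\<^sub>2 = 1"
    and \<phi>: "bounded_linear \<phi>\<^sub>1" "bounded_linear \<phi>\<^sub>2" and e: "norm e = 1"
    and bl: "bounded_linear_wrt (sum_norm F) norm
      (\<lambda>x. f\<^sub>1 *\<^sub>R fst x + f\<^sub>2 *\<^sub>R snd x + (\<phi>\<^sub>1 (fst x) + \<phi>\<^sub>2 (snd x)) *\<^sub>R e)" (is "bounded_linear_wrt ?p norm ?S")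
  shows "1 + (onorm \<phi>\<^sub>1 * c\<^sub>1 + onorm \<phi>\<^sub>2 * c\<^sub>2) \<le> onorm_wrt (sum_norm F) norm
      (\<lambda>x. f\<^sub>1 *\<^sub>R fst x + f\<^sub>2 *\<^sub>R snd x + (\<phi>\<^sub>1 (fst x) + \<phi>\<^sub>2 (snd x)) *\<^sub>R e)"
proof -
  define M where "M = onorm \<phi>\<^sub>1 * c\<^sub>1 + onorm \<phi>\<^sub>2 * c\<^sub>2"
  have c0: "0 \<le> c\<^sub>1" "0 \<le> c\<^sub>2" and Fc: "F (c\<^sub>1, c\<^sub>2) = 1"
    using c by (auto simp: pos_sphere_def)
  have c1: "c\<^sub>1 \<le> 1" "c\<^sub>2 \<le> 1"
    using two_dim_lattice_abs_le[OF F, where a = c\<^sub>1 and b = c\<^sub>2] c0 Fc by simp_all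
  have "0 \<le> M"
    using c0 \<phi> by (simp add: M_def onorm_pos_le)
  have "1 + M \<le> onorm_wrt ?p norm ?S + \<epsilon>" if "0 < \<epsilon>" for \<epsilon>
  proof -
    \<comment> \<open>Each of the two slice choices loses \<open>\<delta>\<close> in the norm, and
      the functional falls short of \<open>M\<close> by at most \<open>2 * \<delta>\<close>.\<close>
    define \<delta> where "\<delta> = \<epsilon> / 4"
    have "0 < \<delta>" using that by (simp add: \<delta>_def)
    obtain u where u: "norm u = 1" "onorm \<phi>\<^sub>1 - \<delta> \<le> \<phi>\<^sub>1 u"
      "norm (M *\<^sub>R e) + f\<^sub>1 * c\<^sub>1 - \<delta> \<le> norm (M *\<^sub>R e + (f\<^sub>1 * c\<^sub>1) *\<^sub>R u)"
      using Daugavet_property_slice[OF D \<phi>(1) _ \<open>0 < \<delta>\<close>, of "f\<^sub>1 * c\<^sub>1" "M *\<^sub>R e"] f c0 by auto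
    define z where "z = M *\<^sub>R e + (f\<^sub>1 * c\<^sub>1) *\<^sub>R u"
    obtain v where v: "norm v = 1" "onorm \<phi>\<^sub>2 - \<delta> \<le> \<phi>\<^sub>2 v"
      "norm z + f\<^sub>2 * c\<^sub>2 - \<delta> \<le> norm (z + (f\<^sub>2 * c\<^sub>2) *\<^sub>R v)"
      using Daugavet_property_slice[OF D \<phi>(2) _ \<open>0 < \<delta>\<close>, of "f\<^sub>2 * c\<^sub>2" z] f c0 by auto
    define x where "x = (c\<^sub>1 *\<^sub>R u, c\<^sub>2 *\<^sub>R v)"
    \<comment> \<open>The shortfall of the functional at \<open>x\<close> from \<open>M\<close>; it
      measures the difference between the sum built from slices and the value of the operator at
      \<open>x\<close>.\<close>
    define s where "s = M - (\<phi>\<^sub>1 (fst x) + \<phi>\<^sub>2 (snd x))"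
    have px: "?p x = 1"
      using u v c0 Fc by (simp add: x_def sum_norm_def)
    have s_eq: "s = c\<^sub>1 * (onorm \<phi>\<^sub>1 - \<phi>\<^sub>1 u) + c\<^sub>2 * (onorm \<phi>\<^sub>2 - \<phi>\<^sub>2 v)"
      using \<phi> by (simp add: s_def M_def x_def linear_simps algebra_simps)
    have "\<phi>\<^sub>1 u \<le> onorm \<phi>\<^sub>1" "\<phi>\<^sub>2 v \<le> onorm \<phi>\<^sub>2"
      using onorm[OF \<phi>(1), of u] onorm[OF \<phi>(2), of v] u v by simp_all
    then have "0 \<le> s"
      using c0 by (simp add: s_eq)
    have "c\<^sub>1 * (onorm \<phi>\<^sub>1 - \<phi>\<^sub>1 u) \<le> 1 * \<delta>" "c\<^sub>2 * (onorm \<phi>\<^sub>2 - \<phi>\<^sub>2 v) \<le> 1 * \<delta>"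
      using c0 c1 u v \<open>\<phi>\<^sub>1 u \<le> onorm \<phi>\<^sub>1\<close> \<open>\<phi>\<^sub>2 v \<le> onorm \<phi>\<^sub>2\<close> by (intro mult_mono; simp)+
    then have "s \<le> 2 * \<delta>"
      by (simp add: s_eq)
    have "z + (f\<^sub>2 * c\<^sub>2) *\<^sub>R v = ?S x + s *\<^sub>R e"
      by (simp add: z_def x_def s_def algebra_simps)
    then have "norm (z + (f\<^sub>2 * c\<^sub>2) *\<^sub>R v) \<le> norm (?S x) + s"
      using norm_triangle_ineq[of "?S x" "s *\<^sub>R e"] e \<open>0 \<le> s\<close> by simp
    moreover have "norm (M *\<^sub>R e) = M"
      using e \<open>0 \<le> M\<close> by simp
    moreover have "norm (?S x) \<le> onorm_wrt ?p norm ?S"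
      using le_onorm_wrt[OF norm_fun_sum_norm[OF F] _ bl, of x] px
      by (simp add: norm_fun_def norm_triangle_ineq)
    ultimately show ?thesis
      using u(3) v(3) f(3) \<open>s \<le> 2 * \<delta>\<close> unfolding z_def[symmetric] by (simp add: \<delta>_def)
  qed
  then show ?thesis
    unfolding M_def[symmetric] by (rule field_le_epsilon)
qed

section \<open>The Daugavet equation for \<open>G\<close>\<close>

theorem proposition6p2:
  fixes F :: "real \<times> real \<Rightarrow> real" and f\<^sub>1 f\<^sub>2 :: real
  assumes "Daugavet_property (norm :: 'a::banach \<Rightarrow> real)"
    and "F \<in> lattice_family 2 2 \<union> lattice_family 2 3"
    and "(f\<^sub>1, f\<^sub>2) \<in> pos_sphere (dual_lattice F)"
    and "affine hull {corner1 F, corner2 F} = {(a\<^sub>1, a\<^sub>2). f\<^sub>1 * a\<^sub>1 + f\<^sub>2 * a\<^sub>2 = 1}"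
  shows "Daugavet_center (sum_norm F :: 'a \<times> 'a \<Rightarrow> real) norm (\<lambda>(x\<^sub>1, x\<^sub>2). f\<^sub>1 *\<^sub>R x\<^sub>1 + f\<^sub>2 *\<^sub>R x\<^sub>2)"
proof -
  let ?p = "sum_norm F :: 'a \<times> 'a \<Rightarrow> real"
  define G where "G x = f\<^sub>1 *\<^sub>R fst x + f\<^sub>2 *\<^sub>R snd x" for x :: "'a \<times> 'a"
  have F: "two_dim_lattice F"
    using assms(2) by (auto simp: lattice_family_def)
  have f: "0 \<le> f\<^sub>1" "0 \<le> f\<^sub>2" "dual_lattice F (f\<^sub>1, f\<^sub>2) = 1"
    using assms(3) by (auto simp: pos_sphere_def)
  \<comment> \<open>Both corners lie on the line through them, hence satisfy its equation.\<close>
  have "corner1 F \<in> affine hull {corner1 F, corner2 F}" "corner2 F \<in> affine hull {corner1 F, corner2 F}"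
    by (simp_all add: hull_inc)
  then have corners: "f\<^sub>1 + f\<^sub>2 * xhat1 F = 1" "f\<^sub>1 * xhat2 F + f\<^sub>2 = 1"
    unfolding assms(4) by (simp_all add: corner1_def corner2_def)
  note p = norm_fun_sum_norm[OF F, where 'a = 'a and 'b = 'a]
  have q: "norm_fun (norm :: 'a \<Rightarrow> real)"
    using banach_norm_norm unfolding banach_norm_def by blast
  \<comment> \<open>Since \<open>(f\<^sub>1, f\<^sub>2)\<close> has dual norm 1, this bounds the
    norm of \<open>G\<close> by 1.\<close>
  have pairing: "f\<^sub>1 * norm (fst x) + f\<^sub>2 * norm (snd x) \<le> ?p x" for x
    using dual_lattice_pairing_le[OF F, of f\<^sub>1 "norm (fst x)" f\<^sub>2 "norm (snd x)"] f
    by (simp add: sum_norm_def case_prod_beta)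
  have G_le: "norm (G x) \<le> 1 * ?p x" for x
    using norm_triangle_ineq[of "f\<^sub>1 *\<^sub>R fst x" "f\<^sub>2 *\<^sub>R snd x"] pairing[of x] f by (simp add: G_def)
  have "linear G"
    by (rule linearI) (simp_all add: G_def algebra_simps)
  then have G: "bounded_linear_wrt ?p norm G"
    using G_le by (auto simp: bounded_linear_wrt_def intro!: exI[of _ 1])
  obtain x0 :: 'a where "x0 \<noteq> 0"
    using assms(1) by (auto simp: Daugavet_property_def Daugavet_center_def)
  have "f\<^sub>1 \<noteq> 0 \<or> f\<^sub>2 \<noteq> 0"
    using corners by auto
  then have "\<exists>x. G x \<noteq> 0"
    using \<open>x0 \<noteq> 0\<close> by (metis G_def add_0 add.right_neutral fst_conv snd_conv scaleR_eq_0_iff scaleR_zero_right)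
  have "onorm_wrt ?p norm (\<lambda>x. G x + T x) = onorm_wrt ?p norm G + onorm_wrt ?p norm T"
    if "rank_one_operator ?p norm T" for T
  proof (rule antisym)
    have T: "bounded_linear_wrt ?p norm T" "dim (range T) = 1"
      using that by (auto simp: rank_one_operator_def)
    show "onorm_wrt ?p norm (\<lambda>x. G x + T x) \<le> onorm_wrt ?p norm G + onorm_wrt ?p norm T"
      by (intro onorm_wrt_triangle p q G T)
    obtain \<phi> e where "linear \<phi>" and e: "norm e = 1" and \<phi>: "\<And>x. T x = \<phi> x *\<^sub>R e"
      using dim_range_one_imp_scaleR[of T] T by (auto simp: bounded_linear_wrt_def)
    interpret \<phi>: linear \<phi> by fact
    obtain K where K: "\<And>x. \<bar>\<phi> x\<bar> \<le> ?p x * K"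
      using T(1) e by (auto simp: bounded_linear_wrt_def \<phi>)
    \<comment> \<open>The restrictions of \<open>\<phi>\<close> to the two copies of the space, each
      of which is embedded isometrically.\<close>
    define \<phi>\<^sub>1 \<phi>\<^sub>2 where "\<phi>\<^sub>1 x = \<phi> (x, 0)" and "\<phi>\<^sub>2 x = \<phi> (0, x)" for x
    have bl: "bounded_linear \<phi>\<^sub>1" "bounded_linear \<phi>\<^sub>2"
    proof -
      have "?p (x, 0) = norm x" "?p (0, x) = norm x" for x
        by (simp_all add: sum_norm_def two_dim_lattice_axis[OF F])
      then have "norm (\<phi>\<^sub>1 x) \<le> norm x * K" "norm (\<phi>\<^sub>2 x) \<le> norm x * K" for x
        using K[of "(x, 0)"] K[of "(0, x)"] by (simp_all add: \<phi>\<^sub>1_def \<phi>\<^sub>2_def)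
      moreover have "linear \<phi>\<^sub>1" "linear \<phi>\<^sub>2"
        by (rule linearI; simp add: \<phi>\<^sub>1_def \<phi>\<^sub>2_def flip: \<phi>.add real_scaleR_def \<phi>.scaleR)+
      ultimately show "bounded_linear \<phi>\<^sub>1" "bounded_linear \<phi>\<^sub>2"
        by (auto simp: bounded_linear_def bounded_linear_axioms_def)
    qed
    have split: "\<phi> x = \<phi>\<^sub>1 (fst x) + \<phi>\<^sub>2 (snd x)" for x
      by (simp add: \<phi>\<^sub>1_def \<phi>\<^sub>2_def flip: \<phi>.add)
    define n\<^sub>1 n\<^sub>2 where "n\<^sub>1 = onorm \<phi>\<^sub>1" and "n\<^sub>2 = onorm \<phi>\<^sub>2"
    have n: "0 \<le> n\<^sub>1" "0 \<le> n\<^sub>2"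
      using bl by (simp_all add: n\<^sub>1_def n\<^sub>2_def onorm_pos_le)
    \<comment> \<open>The larger of the two corner values: it bounds the norm of \<open>T\<close>
      from above, and the corner that attains it gives the lower bound for
      \<open>G + T\<close>.\<close>
    define M where "M = max (n\<^sub>1 + n\<^sub>2 * xhat1 F) (n\<^sub>1 * xhat2 F + n\<^sub>2)"
    have "norm (T x) \<le> M * ?p x" for x
    proof -
      have "norm (T x) \<le> \<bar>\<phi>\<^sub>1 (fst x)\<bar> + \<bar>\<phi>\<^sub>2 (snd x)\<bar>"
        using e abs_triangle_ineq by (simp add: \<phi> split)
      also have "\<dots> \<le> n\<^sub>1 * norm (fst x) + n\<^sub>2 * norm (snd x)"
        using onorm[OF bl(1), of "fst x"] onorm[OF bl(2), of "snd x"] by (simp add: n\<^sub>1_def n\<^sub>2_def)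
      also have "\<dots> \<le> M * ?p x"
        unfolding M_def
        by (rule weighted_sum_le_corner_max[OF f(1,2) n corners pos_sphere_xhat1(2)[OF F]
              pos_sphere_xhat2(2)[OF F] norm_ge_zero norm_le_sum_norm(1)[OF F]
              norm_ge_zero norm_le_sum_norm(2)[OF F] pairing])
      finally show ?thesis .
    qed
    moreover have "0 \<le> M"
      using n pos_sphere_xhat1(1)[OF F] by (simp add: M_def pos_sphere_def le_max_iff_disj)
    ultimately have T_le: "onorm_wrt ?p norm T \<le> M"
      by (intro onorm_wrt_le p)
    have G_norm_le: "onorm_wrt ?p norm G \<le> 1"
      using G_le by (intro onorm_wrt_le p) auto
    have sum_eq: "(\<lambda>x. G x + T x) =
        (\<lambda>x. f\<^sub>1 *\<^sub>R fst x + f\<^sub>2 *\<^sub>R snd x + (\<phi>\<^sub>1 (fst x) + \<phi>\<^sub>2 (snd x)) *\<^sub>R e)"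
      by (simp add: G_def \<phi> split)
    have bl_sum: "bounded_linear_wrt ?p norm (\<lambda>x. G x + T x)"
      by (intro bounded_linear_wrt_add q G T)
    have corner: "1 + (n\<^sub>1 * c\<^sub>1 + n\<^sub>2 * c\<^sub>2) \<le> onorm_wrt ?p norm (\<lambda>x. G x + T x)"
      if "(c\<^sub>1, c\<^sub>2) \<in> pos_sphere F" "f\<^sub>1 * c\<^sub>1 + f\<^sub>2 * c\<^sub>2 = 1" for c\<^sub>1 c\<^sub>2
      using onorm_wrt_corner_ge[OF assms(1) F that(1) f(1,2) that(2) bl e] bl_sum
      unfolding sum_eq n\<^sub>1_def n\<^sub>2_def by blast
    \<comment> \<open>This closes the chain in which the norms of \<open>G\<close> and
      \<open>T\<close> add up to at most \<open>1 + M\<close>, which is at most the norm of the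
      sum.\<close>
    have "1 + M \<le> onorm_wrt ?p norm (\<lambda>x. G x + T x)"
      using corner[OF pos_sphere_xhat1(1)[OF F]] corner[OF pos_sphere_xhat2(1)[OF F]] corners
      by (simp add: M_def max_def)
    with T_le G_norm_le
    show "onorm_wrt ?p norm G + onorm_wrt ?p norm T \<le> onorm_wrt ?p norm (\<lambda>x. G x + T x)"
      by simp
  qed
  then have "Daugavet_center ?p norm G"
    using banach_norm_sum_norm[OF F, where 'a = 'a and 'b = 'a] banach_norm_norm[where 'a = 'a] G
      \<open>\<exists>x. G x \<noteq> 0\<close>
    by (simp add: Daugavet_center_def)
  moreover have "G = (\<lambda>(x\<^sub>1, x\<^sub>2). f\<^sub>1 *\<^sub>R x\<^sub>1 + f\<^sub>2 *\<^sub>R x\<^sub>2)"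
    by (simp add: G_def fun_eq_iff)
  ultimately show ?thesis by simp
qed

end
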